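(* Let $m,n$ be positive integers, let $\mathcal A=(a_{ijkl})\in\mathbb R^{m\times n\times m\times n}$ be a fourth order partially symmetric tensor, let $\alpha,\beta>0$, let $\mathcal B_{\mathcal A}\in\mathbb R^{[4,m+n]}$ be the lifted tensor of $\mathcal A$, and let $\mathbf B_{\alpha,\beta}=\operatorname{diag}(2\beta^2\mathbf I_m,2\alpha^2\mathbf I_n)$. For $\mathbf w\in\mathbb R^{m+n}$ write $\mathbf w=(\mathbf w_x^\top,\mathbf w_y^\top)^\top$ with $\mathbf w_x=(w_1,\dots,w_m)^\top$ and $\mathbf w_y=(w_{m+1},\dots,w_{m+n})^\top$. Then: (1) If $(\lambda,\mathbf x,\mathbf y)$ is an $M$-eigenpair of $\mathcal A$, then $\left(\frac{\lambda}{8\alpha^2\beta^2},\left(\frac1{2\beta}\mathbf x^\top,\frac1{2\alpha}\mathbf y^\top\right)^\top\right)$ is a mode-$1$ $\mathbf B_{\alpha,\beta}$-eigenpair of $\mathcal B_{\mathcal A}$. (2) If $(\lambda,\mathbf w)$ is a mode-$1$ $\mathbf B_{\alpha,\beta}$-eigenpair of $\mathcal B_{\mathcal A}$ with $\lambda\neq0$, then $\left(8\alpha^2\beta^2\lambda,\,2\beta\mathbf w_x,\,2\alpha\mathbf w_y\right)$ is an $M$-eigenpair of $\mathcal A$. (3) Let $(0,\mathbf w)$ be a mode-$1$ $\mathbf B_{\alpha,\beta}$-eigenpair of $\mathcal B_{\mathcal A}$. If $\mathbf w_x\neq\mathbf 0$ and $\mathbf w_y\neq\mathbf 0$, then $\left(0,\frac{\mathbf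 w_x}{\|\mathbf w_x\|_2},\frac{\mathbf w_y}{\|\mathbf w_y\|_2}\right)$ is an $M$-eigenpair of $\mathcal A$. If either $\mathbf w_x=\mathbf 0$ or $\mathbf w_y=\mathbf 0$, this zero eigenpair of the lifted tensor does not correspond to an $M$-eigenpair of $\mathcal A$.
   Context: Notation: $[m]=\{1,\dots,m\}$, $m+[n]=\{m+1,\dots,m+n\}$; $\mathbb R^{[4,N]}$ is the space of real fourth order tensors of size $N\times N\times N\times N$; $\mathbf I_m$ is the $m\times m$ identity matrix. A tensor $\mathcal A=(a_{ijkl})\in\mathbb R^{m\times n\times m\times n}$ is partially symmetric if $a_{ijkl}=a_{kjil}=a_{ilkj}=a_{klij}$ for all $i,k\in[m]$, $j,l\in[n]$. For $\mathbf x\in\mathbb R^m$, $\mathbf y\in\mathbb R^n$ define $\mathcal A\cdot\mathbf y\mathbf x\mathbf y\in\mathbb R^m$ and $\mathcal A\mathbf x\mathbf y\mathbf x\cdot\in\mathbb R^n$ by $$(\mathcal A\cdot\mathbf y\mathbf x\mathbf y)_i=\sum_{k\in[m];\,j,l\in[n]}a_{ijkl}y_jx_ky_l,\qquad(\mathcal A\mathbf x\mathbf y\mathbf x\cdot)_l=\sum_{i,k\in[m];\,j\in[n]}a_{ijkl}x_iy_jx_k.$$ An $M$-eigenpair of $\mathcal A$ is a triple $(\lambda,\mathbf x,\mathbf y)\in\mathbb R\times(\mathbb R^m\setminus\{\mathbf 0\})\times(\mathbb R^n\setminus\{\mathbf 0\})$ with $\mathcal A\cdot\mathbf y\mathbf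 x\mathbf y=\lambda\mathbf x$, $\mathcal A\mathbf x\mathbf y\mathbf x\cdot=\lambda\mathbf y$, $\mathbf x^\top\mathbf x=1$, $\mathbf y^\top\mathbf y=1$. The lifted tensor $\mathcal B_{\mathcal A}=(b_{t_1t_2t_3t_4})\in\mathbb R^{[4,m+n]}$ is $$b_{t_1t_2t_3t_4}=\begin{cases}a_{t_1,\,t_2-m,\,t_3,\,t_4-m},&t_1,t_3\in[m],\ t_2,t_4\in m+[n],\\ a_{t_2,\,t_3-m,\,t_4,\,t_1-m},&t_1,t_3\in m+[n],\ t_2,t_4\in[m],\\0,&\text{otherwise.}\end{cases}$$ For $\mathcal T=(\tau_{t_1t_2t_3t_4})\in\mathbb R^{[4,m+n]}$ and $\mathbf w\in\mathbb R^{m+n}$, $(\mathcal T^{(1)}\mathbf w^3)_{t_1}=\sum_{t_2,t_3,t_4}\tau_{t_1t_2t_3t_4}w_{t_2}w_{t_3}w_{t_4}$. A pair $(\lambda,\mathbf w)\in\mathbb R\times(\mathbb R^{m+n}\setminus\{\mathbf 0\})$ is a mode-$1$ $\mathbf B_{\alpha,\beta}$-eigenpair of $\mathcal T$ if $\mathcal T^{(1)}\mathbf w^3=\lambda\mathbf B_{\alpha,\beta}\mathbf w$ and $\mathbf w^\top\mathbf B_{\alpha,\beta}\mathbf w=1$. *)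

theory Defs
  imports "HOL-Analysis.Analysis"
begin

text \<open>
  The index sets \<open>[m]\<close> and \<open>[n]\<close> are finite types \<open>'m\<close> and \<open>'n\<close> (nonempty, as all types are,
  so \<open>m, n \<ge> 1\<close>). The index set \<open>[m+n]\<close> is the sum type \<open>'m + 'n\<close>: \<open>Inl i\<close> is the index
  \<open>i\<close> in \<open>[m]\<close> and \<open>Inr j\<close> is the index \<open>m + j\<close> in \<open>m + [n]\<close>.
  The entry \<open>a\<^sub>i\<^sub>j\<^sub>k\<^sub>l\<close> of a tensor is \<open>A $ i $ j $ k $ l\<close>.
\<close>

type_synonym ('p, 'q, 'r, 's) tensor4 = "real ^ 's ^ 'r ^ 'q ^ 'p"

definition partially_symmetric :: "('m::finite, 'n::finite, 'm, 'n) tensor4 \<Rightarrow> bool" where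
  "partially_symmetric A \<longleftrightarrow>
     (\<forall>i j k l. A $ i $ j $ k $ l = A $ k $ j $ i $ l \<and>
                A $ i $ j $ k $ l = A $ i $ l $ k $ j \<and>
                A $ i $ j $ k $ l = A $ k $ l $ i $ j)"

text \<open>\<open>A\<cdot>yxy\<close>, a vector indexed by the first mode.\<close>

definition tensor_yxy ::
  "('m::finite, 'n::finite, 'm, 'n) tensor4 \<Rightarrow> real ^ 'm \<Rightarrow> real ^ 'n \<Rightarrow> real ^ 'm" where
  "tensor_yxy A x y =
     (\<chi> i. \<Sum>k\<in>UNIV. \<Sum>j\<in>UNIV. \<Sum>l\<in>UNIV. A $ i $ j $ k $ l * y $ j * x $ k * y $ l)"

text \<open>\<open>Axyx\<cdot>\<close>, a vector indexed by the fourth mode.\<close>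

definition tensor_xyx ::
  "('m::finite, 'n::finite, 'm, 'n) tensor4 \<Rightarrow> real ^ 'm \<Rightarrow> real ^ 'n \<Rightarrow> real ^ 'n" where
  "tensor_xyx A x y =
     (\<chi> l. \<Sum>i\<in>UNIV. \<Sum>k\<in>UNIV. \<Sum>j\<in>UNIV. A $ i $ j $ k $ l * x $ i * y $ j * x $ k)"

definition M_eigenpair ::
  "('m::finite, 'n::finite, 'm, 'n) tensor4 \<Rightarrow> real \<Rightarrow> real ^ 'm \<Rightarrow> real ^ 'n \<Rightarrow> bool" where
  "M_eigenpair A lam x y \<longleftrightarrow>
     x \<noteq> 0 \<and> y \<noteq> 0 \<and>
     tensor_yxy A x y = lam *\<^sub>R x \<and> tensor_xyx A x y = lam *\<^sub>R y \<and>
     x \<bullet> x = 1 \<and> y \<bullet> y = 1"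

definition lifted_tensor ::
  "('m::finite, 'n::finite, 'm, 'n) tensor4 \<Rightarrow>
   ('m + 'n, 'm + 'n, 'm + 'n, 'm + 'n) tensor4" where
  "lifted_tensor A = (\<chi> t1 t2 t3 t4.
     (case (t1, t2, t3, t4) of
        (Inl p, Inr q, Inl r, Inr s) \<Rightarrow> A $ p $ q $ r $ s
      | (Inr p, Inl q, Inr r, Inl s) \<Rightarrow> A $ q $ r $ s $ p
      | _ \<Rightarrow> 0))"

text \<open>\<open>B\<^sub>\<alpha>\<^sub>\<beta> = diag (2\<beta>\<^sup>2 I\<^sub>m, 2\<alpha>\<^sup>2 I\<^sub>n)\<close>; the \<open>x\<close>-block carries \<open>\<beta>\<close>, the \<open>y\<close>-block \<open>\<alpha>\<close>.\<close>

definition B_matrix ::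
  "real \<Rightarrow> real \<Rightarrow> real ^ ('m::finite + 'n::finite) ^ ('m + 'n)" where
  "B_matrix \<alpha> \<beta> = (\<chi> s t. if s = t
     then (case s of Inl i \<Rightarrow> 2 * \<beta>\<^sup>2 | Inr j \<Rightarrow> 2 * \<alpha>\<^sup>2)
     else 0)"

definition mode1_apply :: "('N::finite, 'N, 'N, 'N) tensor4 \<Rightarrow> real ^ 'N \<Rightarrow> real ^ 'N" where
  "mode1_apply T w =
     (\<chi> t1. \<Sum>t2\<in>UNIV. \<Sum>t3\<in>UNIV. \<Sum>t4\<in>UNIV. T $ t1 $ t2 $ t3 $ t4 * w $ t2 * w $ t3 * w $ t4)"

definition mode1_eigenpair ::
  "real ^ 'N ^ 'N \<Rightarrow> ('N::finite, 'N, 'N, 'N) tensor4 \<Rightarrow> real \<Rightarrow> real ^ 'N \<Rightarrow> bool" where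
  "mode1_eigenpair B T lam w \<longleftrightarrow>
     w \<noteq> 0 \<and> mode1_apply T w = lam *\<^sub>R (B *v w) \<and> w \<bullet> (B *v w) = 1"

definition join_vec :: "real ^ 'm \<Rightarrow> real ^ 'n \<Rightarrow> real ^ ('m::finite + 'n::finite)" where
  "join_vec x y = (\<chi> t. case t of Inl i \<Rightarrow> x $ i | Inr j \<Rightarrow> y $ j)"

definition x_part :: "real ^ ('m::finite + 'n::finite) \<Rightarrow> real ^ 'm" where
  "x_part w = (\<chi> i. w $ Inl i)"

definition y_part :: "real ^ ('m::finite + 'n::finite) \<Rightarrow> real ^ 'n" where
  "y_part w = (\<chi> j. w $ Inr j)"

text \<open>
  A triple \<open>(\<mu>, x, y)\<close> corresponds to a lifted eigenvector \<open>w\<close> if \<open>x\<close> and \<open>y\<close> are obtained by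
  rescaling the two blocks of \<open>w\<close>. This covers both the scaling by \<open>2\<beta>\<close>, \<open>2\<alpha>\<close> (equivalently
  \<open>w = (x / (2\<beta>), y / (2\<alpha>))\<close>) and the blockwise normalisation. The eigenvalue \<open>\<mu>\<close> is
  unrestricted, which makes non-correspondence the stronger claim.
\<close>

definition corresponds_to_M_eigenpair ::
  "('m::finite, 'n::finite, 'm, 'n) tensor4 \<Rightarrow> real ^ ('m + 'n) \<Rightarrow> bool" where
  "corresponds_to_M_eigenpair A w \<longleftrightarrow>
     (\<exists>\<mu> x y c d. M_eigenpair A \<mu> x y \<and> x = c *\<^sub>R x_part w \<and> y = d *\<^sub>R y_part w)"

end

(*
  Block by block, the lifted tensor applied to w = (x, y) gives (A.yxy, Axyx.), and the matrix
  acts as (2 beta^2 x, 2 alpha^2 y). Hence lifted eigenpairs are joint solutions of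
  A.yxy = 2 beta^2 lam x and Axyx. = 2 alpha^2 lam y with a weighted normalisation. Pairing these
  with x and y yields the same quartic form, so for lam <> 0 both blocks carry weight 1/2 of the
  normalisation. The rest is homogeneity of the two maps.
*)

theory Submission
  imports Defs
begin

lemma sum_UNIV_Plus:
  fixes f :: "'a::finite + 'b::finite \<Rightarrow> 'c::comm_monoid_add"
  shows "(\<Sum>t\<in>UNIV. f t) = (\<Sum>i\<in>UNIV. f (Inl i)) + (\<Sum>j\<in>UNIV. f (Inr j))"
  unfolding UNIV_Plus_UNIV[symmetric] by (subst sum.Plus) (simp_all add: o_def)

lemma x_part_join_vec [simp]: "x_part (join_vec x y) = x"
  by (simp add: x_part_def join_vec_def vec_eq_iff)

lemma y_part_join_vec [simp]: "y_part (join_vec x y) = y"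
  by (simp add: y_part_def join_vec_def vec_eq_iff)

lemma vec_eq_iff_parts:
  "v = w \<longleftrightarrow> x_part v = x_part w \<and> y_part v = y_part w"
  by (simp add: vec_eq_iff x_part_def y_part_def split_sum_all)

lemma parts_zero [simp]: "x_part 0 = 0" "y_part 0 = 0"
  by (simp_all add: x_part_def y_part_def vec_eq_iff)

lemma parts_scaleR [simp]:
  "x_part (c *\<^sub>R w) = c *\<^sub>R x_part w" "y_part (c *\<^sub>R w) = c *\<^sub>R y_part w"
  by (simp_all add: x_part_def y_part_def vec_eq_iff)

lemma inner_eq_parts: "v \<bullet> w = x_part v \<bullet> x_part w + y_part v \<bullet> y_part w"
  by (simp add: inner_vec_def x_part_def y_part_def sum_UNIV_Plus)

lemma x_part_B_matrix: "x_part (B_matrix \<alpha> \<beta> *v w) = (2 * \<beta>\<^sup>2) *\<^sub>R x_part w"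
  by (simp add: x_part_def B_matrix_def matrix_vector_mult_def vec_eq_iff if_distrib
      if_distribR cong: if_cong)

lemma y_part_B_matrix: "y_part (B_matrix \<alpha> \<beta> *v w) = (2 * \<alpha>\<^sup>2) *\<^sub>R y_part w"
  by (simp add: y_part_def B_matrix_def matrix_vector_mult_def vec_eq_iff if_distrib
      if_distribR cong: if_cong)

text \<open>With \<open>Inl i\<close> as first index, only the pattern \<open>Inr\<close>,
  \<open>Inl\<close>, \<open>Inr\<close> of the other three can give a nonzero entry. What remains
  is the order of the sums over \<open>j\<close> and \<open>k\<close>.\<close>

lemma x_part_mode1_apply_lifted:
  "x_part (mode1_apply (lifted_tensor A) w) = tensor_yxy A (x_part w) (y_part w)"
proof -
  have "(\<Sum>j\<in>UNIV. \<Sum>k\<in>UNIV. \<Sum>l\<in>UNIV. A $ i $ j $ k $ l * w $ Inr j * w $ Inl k * w $ Inr l) =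
      (\<Sum>k\<in>UNIV. \<Sum>j\<in>UNIV. \<Sum>l\<in>UNIV. A $ i $ j $ k $ l * w $ Inr j * w $ Inl k * w $ Inr l)"
    for i by (rule sum.swap)
  then show ?thesis
    by (simp add: x_part_def y_part_def mode1_apply_def lifted_tensor_def tensor_yxy_def
        sum_UNIV_Plus vec_eq_iff)
qed

text \<open>In the second case of \<open>lifted_tensor\<close> the cyclic shift of indices moves the
  first index to the fourth mode of \<open>A\<close>, which is the mode that
  \<open>tensor_xyx\<close> leaves free.\<close>

lemma y_part_mode1_apply_lifted:
  "y_part (mode1_apply (lifted_tensor A) w) = tensor_xyx A (x_part w) (y_part w)"
proof -
  have "(\<Sum>j\<in>UNIV. \<Sum>k\<in>UNIV. A $ i $ j $ k $ l * w $ Inl i * w $ Inr j * w $ Inl k) =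
      (\<Sum>k\<in>UNIV. \<Sum>j\<in>UNIV. A $ i $ j $ k $ l * w $ Inl i * w $ Inr j * w $ Inl k)"
    for i l by (rule sum.swap)
  then show ?thesis
    by (simp add: x_part_def y_part_def mode1_apply_def lifted_tensor_def tensor_xyx_def
        sum_UNIV_Plus vec_eq_iff)
qed

lemma mode1_eigenpair_lifted_iff:
  "mode1_eigenpair (B_matrix \<alpha> \<beta>) (lifted_tensor A) lam w \<longleftrightarrow>
     (x_part w \<noteq> 0 \<or> y_part w \<noteq> 0) \<and>
     tensor_yxy A (x_part w) (y_part w) = (lam * (2 * \<beta>\<^sup>2)) *\<^sub>R x_part w \<and>
     tensor_xyx A (x_part w) (y_part w) = (lam * (2 * \<alpha>\<^sup>2)) *\<^sub>R y_part w \<and>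
     2 * \<beta>\<^sup>2 * (x_part w \<bullet> x_part w) + 2 * \<alpha>\<^sup>2 * (y_part w \<bullet> y_part w) = 1"
  unfolding mode1_eigenpair_def inner_eq_parts
  by (auto simp: vec_eq_iff_parts[of _ "0"] vec_eq_iff_parts[of "mode1_apply _ _"]
      x_part_mode1_apply_lifted y_part_mode1_apply_lifted x_part_B_matrix y_part_B_matrix)

lemma tensor_yxy_scaleR:
  "tensor_yxy A (c *\<^sub>R x) (d *\<^sub>R y) = (c * d\<^sup>2) *\<^sub>R tensor_yxy A x y"
  by (simp add: tensor_yxy_def vec_eq_iff sum_distrib_left power2_eq_square mult_ac)

lemma tensor_xyx_scaleR:
  "tensor_xyx A (c *\<^sub>R x) (d *\<^sub>R y) = (c\<^sup>2 * d) *\<^sub>R tensor_xyx A x y"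
  by (simp add: tensor_xyx_def vec_eq_iff sum_distrib_left power2_eq_square mult_ac)

text \<open>Both sides are the quartic form with terms \<open>?f i j k l\<close>. The index
  \<open>l\<close> is moved from the innermost to the outermost sum by adjacent swaps.\<close>

lemma inner_tensor_yxy_eq_inner_tensor_xyx:
  "x \<bullet> tensor_yxy A x y = y \<bullet> tensor_xyx A x y"
proof -
  let ?f = "\<lambda>i j k l. A $ i $ j $ k $ l * x $ i * y $ j * x $ k * y $ l"
  have "x \<bullet> tensor_yxy A x y = (\<Sum>i\<in>UNIV. \<Sum>k\<in>UNIV. \<Sum>j\<in>UNIV. \<Sum>l\<in>UNIV. ?f i j k l)"
    by (simp add: inner_vec_def tensor_yxy_def sum_distrib_left mult_ac)
  also have "\<dots> = (\<Sum>i\<in>UNIV. \<Sum>k\<in>UNIV. \<Sum>l\<in>UNIV. \<Sum>j\<in>UNIV. ?f i j k l)"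
    by (intro sum.cong refl sum.swap)
  also have "\<dots> = (\<Sum>i\<in>UNIV. \<Sum>l\<in>UNIV. \<Sum>k\<in>UNIV. \<Sum>j\<in>UNIV. ?f i j k l)"
    by (intro sum.cong refl sum.swap)
  also have "\<dots> = (\<Sum>l\<in>UNIV. \<Sum>i\<in>UNIV. \<Sum>k\<in>UNIV. \<Sum>j\<in>UNIV. ?f i j k l)"
    by (rule sum.swap)
  also have "\<dots> = y \<bullet> tensor_xyx A x y"
    by (simp add: inner_vec_def tensor_xyx_def sum_distrib_left mult_ac)
  finally show ?thesis .
qed

lemma mode1_eigenpair_of_M_eigenpair:
  assumes "M_eigenpair A lam x y" and "\<alpha> > 0" and "\<beta> > 0"
  shows "mode1_eigenpair (B_matrix \<alpha> \<beta>) (lifted_tensor A) (lam / (8 * \<alpha>\<^sup>2 * \<beta>\<^sup>2))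
    (join_vec ((1 / (2 * \<beta>)) *\<^sub>R x) ((1 / (2 * \<alpha>)) *\<^sub>R y))"
proof -
  \<comment> \<open>Normalisation: each unit vector, once rescaled, contributes 1/2.\<close>
  have "2 * \<beta>\<^sup>2 * (1 / (2 * \<beta>) * (1 / (2 * \<beta>))) + 2 * \<alpha>\<^sup>2 * (1 / (2 * \<alpha>) * (1 / (2 * \<alpha>))) = 1"
    using assms by (simp add: field_simps power2_eq_square)
  \<comment> \<open>Eigenvalue equations per block: on the left the homogeneity factor times
    \<open>lam\<close>, on the right the new eigenvalue times the diagonal entry times the block's
    scale.\<close>
  moreover have "1 / (2 * \<beta>) * (1 / (2 * \<alpha>))\<^sup>2 * lam =
      lam / (8 * \<alpha>\<^sup>2 * \<beta>\<^sup>2) * (2 * \<beta>\<^sup>2) * (1 / (2 * \<beta>))"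
    and "(1 / (2 * \<beta>))\<^sup>2 * (1 / (2 * \<alpha>)) * lam =
      lam / (8 * \<alpha>\<^sup>2 * \<beta>\<^sup>2) * (2 * \<alpha>\<^sup>2) * (1 / (2 * \<alpha>))"
    using assms by (simp_all add: field_simps power2_eq_square)
  ultimately show ?thesis
    using assms unfolding mode1_eigenpair_lifted_iff M_eigenpair_def x_part_join_vec y_part_join_vec
      tensor_yxy_scaleR tensor_xyx_scaleR
    by (auto simp only: scaleR_scaleR inner_scaleR_left inner_scaleR_right scaleR_eq_0_iff
        mult_1_right mult.assoc divide_eq_0_iff mult_eq_0_iff one_neq_zero zero_neq_numeral
        dest: less_imp_neq)
qed

lemma M_eigenpair_of_mode1_eigenpair:
  assumes "mode1_eigenpair (B_matrix \<alpha> \<beta>) (lifted_tensor A) lam w" and "lam \<noteq> 0"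
  shows "M_eigenpair A (8 * \<alpha>\<^sup>2 * \<beta>\<^sup>2 * lam) ((2 * \<beta>) *\<^sub>R x_part w) ((2 * \<alpha>) *\<^sub>R y_part w)"
proof -
  let ?x = "x_part w" and ?y = "y_part w"
  have yxy: "tensor_yxy A ?x ?y = (lam * (2 * \<beta>\<^sup>2)) *\<^sub>R ?x"
    and xyx: "tensor_xyx A ?x ?y = (lam * (2 * \<alpha>\<^sup>2)) *\<^sub>R ?y"
    and norm: "2 * \<beta>\<^sup>2 * (?x \<bullet> ?x) + 2 * \<alpha>\<^sup>2 * (?y \<bullet> ?y) = 1"
    using assms(1) by (simp_all add: mode1_eigenpair_lifted_iff)
  \<comment> \<open>The two block equations are paired with \<open>?x\<close> and \<open>?y\<close>;
    both give the quartic form.\<close>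
  have "lam * (2 * \<beta>\<^sup>2) * (?x \<bullet> ?x) = lam * (2 * \<alpha>\<^sup>2) * (?y \<bullet> ?y)"
    using inner_tensor_yxy_eq_inner_tensor_xyx[of ?x A ?y] by (simp add: yxy xyx)
  \<comment> \<open>After cancelling \<open>lam\<close>, the two summands of \<open>norm\<close> are
    equal, so each is 1/2; doubling gives the unit norms below, which also rule out a zero
    block.\<close>
  then have "2 * \<beta>\<^sup>2 * (?x \<bullet> ?x) = 2 * \<alpha>\<^sup>2 * (?y \<bullet> ?y)"
    using \<open>lam \<noteq> 0\<close> by simp
  with norm have unit: "((2 * \<beta>) *\<^sub>R ?x) \<bullet> ((2 * \<beta>) *\<^sub>R ?x) = 1" "((2 * \<alpha>) *\<^sub>R ?y) \<bullet> ((2 * \<alpha>) *\<^sub>R ?y) = 1"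
    by (simp_all add: power2_eq_square)
  have "(2 * \<beta>) *\<^sub>R ?x \<noteq> 0" "(2 * \<alpha>) *\<^sub>R ?y \<noteq> 0"
    using unit by fastforce+
  moreover have "2 * \<beta> * (2 * \<alpha>)\<^sup>2 * (lam * (2 * \<beta>\<^sup>2)) = 8 * \<alpha>\<^sup>2 * \<beta>\<^sup>2 * lam * (2 * \<beta>)"
    and "(2 * \<beta>)\<^sup>2 * (2 * \<alpha>) * (lam * (2 * \<alpha>\<^sup>2)) = 8 * \<alpha>\<^sup>2 * \<beta>\<^sup>2 * lam * (2 * \<alpha>)"
    by (simp_all add: power2_eq_square)
  ultimately show ?thesis
    unfolding M_eigenpair_def tensor_yxy_scaleR tensor_xyx_scaleR yxy xyx scaleR_scaleR
    using unit by presburger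
qed

text \<open>For eigenvalue 0 both maps vanish at the blocks, and by homogeneity at all their
  rescalings, so each block can be normalised independently.\<close>

lemma M_eigenpair_zero_of_mode1_eigenpair:
  assumes "mode1_eigenpair (B_matrix \<alpha> \<beta>) (lifted_tensor A) 0 w"
    and "x_part w \<noteq> 0" and "y_part w \<noteq> 0"
  shows "M_eigenpair A 0 (x_part w /\<^sub>R norm (x_part w)) (y_part w /\<^sub>R norm (y_part w))"
  using assms
  \<comment> \<open>Removing the inner product rules keeps \<open>v \<bullet> v = 1\<close> intact,
    so that it is rewritten to \<open>norm v = 1\<close>.\<close>
  by (simp add: mode1_eigenpair_lifted_iff M_eigenpair_def tensor_yxy_scaleR tensor_xyx_scaleR
      norm_eq_1[symmetric] del: inner_scaleR_left inner_scaleR_right)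

text \<open>Every multiple of a zero block is zero, but both vectors of an M-eigenpair are nonzero.
  The contrapositive is the last claim of the theorem.\<close>

lemma corresponds_to_M_eigenpair_nonzero:
  assumes "corresponds_to_M_eigenpair A w"
  shows "x_part w \<noteq> 0" and "y_part w \<noteq> 0"
  using assms by (auto simp: corresponds_to_M_eigenpair_def M_eigenpair_def)

theorem theorem2p1:
  fixes A :: "('m::finite, 'n::finite, 'm, 'n) tensor4"
    and \<alpha> \<beta> :: real
  assumes "partially_symmetric A" and "\<alpha> > 0" and "\<beta> > 0"
  shows
    "(\<forall>lam x y. M_eigenpair A lam x y \<longrightarrow>
        mode1_eigenpair (B_matrix \<alpha> \<beta>) (lifted_tensor A)
          (lam / (8 * \<alpha>\<^sup>2 * \<beta>\<^sup>2))
          (join_vec ((1 / (2 * \<beta>)) *\<^sub>R x) ((1 / (2 * \<alpha>)) *\<^sub>R y))) \<and>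
     (\<forall>lam w. mode1_eigenpair (B_matrix \<alpha> \<beta>) (lifted_tensor A) lam w \<and> lam \<noteq> 0 \<longrightarrow>
        M_eigenpair A (8 * \<alpha>\<^sup>2 * \<beta>\<^sup>2 * lam) ((2 * \<beta>) *\<^sub>R x_part w) ((2 * \<alpha>) *\<^sub>R y_part w)) \<and>
     (\<forall>w. mode1_eigenpair (B_matrix \<alpha> \<beta>) (lifted_tensor A) 0 w \<longrightarrow>
        (x_part w \<noteq> 0 \<and> y_part w \<noteq> 0 \<longrightarrow>
           M_eigenpair A 0 (x_part w /\<^sub>R norm (x_part w)) (y_part w /\<^sub>R norm (y_part w))) \<and>
        (x_part w = 0 \<or> y_part w = 0 \<longrightarrow> \<not> corresponds_to_M_eigenpair A w))"
  using assms(2,3) mode1_eigenpair_of_M_eigenpair M_eigenpair_of_mode1_eigenpair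
    M_eigenpair_zero_of_mode1_eigenpair corresponds_to_M_eigenpair_nonzero
  by blast

end
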